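(* Let $A\subset\mathbb{N}$ be a finite set with $|A|=N$, and for $n\in\mathbb{Z}$ let $r(n)=|\{(a,b)\in A^2: a-b=n\}|$. Let $E(A)=\sum_{n\in\mathbb{Z}} r(n)^2$ be the additive energy of $A$. Then, provided $N$ is sufficiently large, \[\sum_{\substack{n_i,n_j\in A-A\\ n_i,n_j>0}} \frac{(n_i,n_j)}{\sqrt{n_in_j}}\, r(n_i)r(n_j) \ll (\log N)^{O(1)}\exp\!\Big(O\Big(\big(\log\tfrac{N^3}{E(A)}\,\log\log N\big)^{1/2}\Big)\Big)\,E(A).\]
   Context: $(m,n)$ denotes the greatest common divisor; $A-A=\{a-b:a,b\in A\}$. $X\ll Y$ means $|X|\leqslant C|Y|$ for an absolute constant $C$; $O(\cdot)$ terms are bounded by absolute constants times the indicated expression. *)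

theory Defs
  imports Complex_Main "HOL-Library.Groups_Big_Fun"
begin

text \<open>The difference set is taken in the integers, since subtraction on naturals truncates.\<close>

definition diff_set :: "nat set \<Rightarrow> int set" where
  "diff_set A = {int a - int b | a b. a \<in> A \<and> b \<in> A}"

definition diff_rep :: "nat set \<Rightarrow> int \<Rightarrow> nat" where
  "diff_rep A n = card {(a, b). a \<in> A \<and> b \<in> A \<and> int a - int b = n}"

text \<open>\<^const>\<open>Sum_any\<close> sums over all integers; for finite \<open>A\<close> the summand has finite support,
  as that operator requires.\<close>

definition additive_energy :: "nat set \<Rightarrow> nat" where
  "additive_energy A = Sum_any (\<lambda>n::int. (diff_rep A n)\<^sup>2)"

lemma finite_diff_set: "finite A \<Longrightarrow> finite (diff_set A)"
proof -
  assume "finite A"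
  moreover have "diff_set A = (\<lambda>(a, b). int a - int b) ` (A \<times> A)"
    by (auto simp: diff_set_def)
  ultimately show ?thesis by simp
qed

lemma diff_rep_outside: "n \<notin> diff_set A \<Longrightarrow> diff_rep A n = 0"
proof -
  assume "n \<notin> diff_set A"
  then have "{(a, b). a \<in> A \<and> b \<in> A \<and> int a - int b = n} = {}"
    by (auto simp: diff_set_def)
  then show ?thesis by (simp only: diff_rep_def card.empty)
qed

lemma additive_energy_eq_sum:
  assumes "finite A"
  shows "additive_energy A = (\<Sum>n\<in>diff_set A. (diff_rep A n)\<^sup>2)"
  unfolding additive_energy_def
  by (rule Sum_any.expand_superset)
    (use assms finite_diff_set diff_rep_outside in \<open>auto intro: ccontr\<close>)

end

theory Submission
  imports Defs "HOL-Analysis.Harmonic_Numbers" "HOL-Analysis.Convex"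
begin

text \<open>
  Write \<open>N = |A|\<close>, \<open>K = N\<^sup>3 / E(A)\<close>, and let \<open>P\<close> be the convolution operator on functions on the
  positive rationals with kernel \<open>\<Sum> 1 / sqrt (u v)\<close> at \<open>u / v\<close>, where \<open>u, v \<le> Y = N\<^sup>4\<close>. Up to an
  error \<open>E(A)\<close> the GCD sum is at most \<open>\<langle>r, P r\<rangle>\<close>. As \<open>P\<close> is self-adjoint, repeated Cauchy--Schwarz gives
  \<open>\<langle>r, P r\<rangle>\<^sup>k \<le> \<parallel>r\<parallel>\<^sup>2\<^sup>k\<^sup>-\<^sup>2 \<langle>r, P\<^sup>k r\<rangle>\<close> for \<open>k\<close> a power of two, and a further Cauchy--Schwarz over
  ratios bounds \<open>\<langle>r, P\<^sup>k r\<rangle>\<^sup>2\<close> by the multiplicative energy of \<open>r\<close> times the sum of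
  \<open>1 / (u\<^sub>1 \<dots> u\<^sub>2\<^sub>k)\<close> over the solutions of \<open>u\<^sub>1 \<dots> u\<^sub>2\<^sub>k = v\<^sub>1 \<dots> v\<^sub>2\<^sub>k\<close> in \<open>{1..Y}\<close>, which is
  \<open>(log N)\<close> to the power \<open>O(k\<^sup>2)\<close>. The multiplicative energy counts solutions of
  \<open>(a - b)(c' - d') = (a' - b')(c - d)\<close> in \<open>A\<close>; it is controlled by the number of collinear triples in the
  grid \<open>A \<times> A\<close>, hence is \<open>O(N\<^sup>6 log N) = O(K\<^sup>2 E(A)\<^sup>2 log N)\<close> by a Szemeredi--Trotter bound, which for
  grids has an elementary proof. Taking \<open>k\<close> of order \<open>sqrt (log K / log log N)\<close> balances \<open>K\<close> to the
  power \<open>1 / k\<close> against \<open>(log N)\<close> to the power \<open>O(k)\<close>.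
\<close>

section \<open>Rich lines in a grid\<close>

text \<open>Fix a representative in each fibre; every other point forms a pair with its
  representative, and these pairs are distinct. This turns the excess of points on a line over the
  cells it meets into pairs sharing a cell.\<close>

lemma card_le_fibre_pairs:
  assumes "finite S" "finite T" "\<phi> ` S \<subseteq> T"
  shows "card S \<le> card T + card {(p, q) \<in> S \<times> S. p \<noteq> q \<and> \<phi> p = \<phi> q}"
proof -
  define rep where "rep t = (SOME q. q \<in> S \<and> \<phi> q = t)" for t
  have rep: "rep (\<phi> p) \<in> S \<and> \<phi> (rep (\<phi> p)) = \<phi> p" if "p \<in> S" for p
    unfolding rep_def by (rule someI[of _ p]) (use that in auto)
  let ?R = "{p \<in> S. rep (\<phi> p) = p}" and ?S' = "{p \<in> S. rep (\<phi> p) \<noteq> p}"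
  let ?Q = "{(p, q) \<in> S \<times> S. p \<noteq> q \<and> \<phi> p = \<phi> q}"
  have "inj_on \<phi> ?R" by (metis (mono_tags, lifting) inj_onI mem_Collect_eq)
  then have 1: "card ?R \<le> card T"
    using assms by (intro card_inj_on_le) auto
  have 2: "card ?S' \<le> card ?Q"
  proof (rule card_inj_on_le[where f = "\<lambda>p. (p, rep (\<phi> p))"])
    show "inj_on (\<lambda>p. (p, rep (\<phi> p))) ?S'" by (auto simp: inj_on_def)
    show "(\<lambda>p. (p, rep (\<phi> p))) ` ?S' \<subseteq> ?Q" using rep by fastforce
    show "finite ?Q" by (rule finite_subset[of _ "S \<times> S"]) (use assms in auto)
  qed
  have "card (?R \<union> ?S') \<le> card ?R + card ?S'" by (rule card_Un_le)
  moreover have "?R \<union> ?S' = S" by auto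
  ultimately have "card S \<le> card ?R + card ?S'" by simp
  then show ?thesis using 1 2 by linarith
qed

text \<open>Blocks of consecutive elements are level sets of \<open>rank_in A a div s\<close>.
  Cutting by rank keeps each block at size at most \<open>s\<close>, however unevenly
  \<open>A\<close> is spaced.\<close>

definition rank_in :: "nat set \<Rightarrow> nat \<Rightarrow> nat" where
  "rank_in A a = card {x \<in> A. x < a}"

lemma rank_in_mono: "finite A \<Longrightarrow> a \<le> b \<Longrightarrow> rank_in A a \<le> rank_in A b"
  unfolding rank_in_def by (intro card_mono) auto

lemma rank_in_less_card: "finite A \<Longrightarrow> a \<in> A \<Longrightarrow> rank_in A a < card A"
  unfolding rank_in_def by (intro psubset_card_mono) auto

lemma rank_in_strict_mono: "finite A \<Longrightarrow> a \<in> A \<Longrightarrow> a < b \<Longrightarrow> rank_in A a < rank_in A b"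
  unfolding rank_in_def by (intro psubset_card_mono) auto

lemma inj_on_rank_in: "finite A \<Longrightarrow> inj_on (rank_in A) A"
  by (metis inj_onI linorder_neqE_nat nat_less_le rank_in_strict_mono)

lemma card_rank_block_le:
  assumes "finite A" "s > 0"
  shows "card {a \<in> A. rank_in A a div s = i} \<le> s"
proof -
  have "card {a \<in> A. rank_in A a div s = i} \<le> card {i * s..<i * s + s}"
  proof (rule card_inj_on_le[where f = "rank_in A"])
    show "inj_on (rank_in A) {a \<in> A. rank_in A a div s = i}"
      using inj_on_rank_in[OF assms(1)] by (rule inj_on_subset) auto
    show "rank_in A ` {a \<in> A. rank_in A a div s = i} \<subseteq> {i * s..<i * s + s}"
    proof
      fix x assume "x \<in> rank_in A ` {a \<in> A. rank_in A a div s = i}"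
      then have x: "x div s = i" by auto
      have "x = s * i + x mod s" using x by (metis mult_div_mod_eq)
      moreover have "x mod s < s" using assms(2) by simp
      ultimately show "x \<in> {i * s..<i * s + s}" by (simp add: mult.commute)
    qed
  qed auto
  then show ?thesis by simp
qed

text \<open>A pair \<open>l = (x, y)\<close> stands for the line with slope \<open>x\<close> and intercept \<open>y\<close>.\<close>

definition line_points :: "nat set \<Rightarrow> real \<times> real \<Rightarrow> (nat \<times> nat) set" where
  "line_points A l = {(c, a). c \<in> A \<and> a \<in> A \<and> real a = fst l * real c + snd l}"

text \<open>Ratios of positive differences are positive slopes, and positivity makes the lines
  monotone. Requiring two points leaves finitely many lines.\<close>

definition grid_lines :: "nat set \<Rightarrow> (real \<times> real) set" where
  "grid_lines A = {l. fst l > 0 \<and> card (line_points A l) \<ge> 2}"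

lemma line_points_subset: "line_points A l \<subseteq> A \<times> A"
  by (auto simp: line_points_def)

lemma finite_line_points: "finite A \<Longrightarrow> finite (line_points A l)"
  by (rule finite_subset[OF line_points_subset]) simp

lemma card_line_points_le:
  assumes "finite A"
  shows "card (line_points A l) \<le> card A"
  by (rule card_inj_on_le[where f = fst]) (use assms in \<open>auto simp: line_points_def inj_on_def\<close>)

lemma line_points_mono:
  assumes "fst l > 0" "p \<in> line_points A l" "q \<in> line_points A l" "fst p \<le> fst q"
  shows "snd p \<le> snd q"
proof -
  have "fst l * real (fst p) \<le> fst l * real (fst q)" using assms by simp
  then have "real (snd p) \<le> real (snd q)" using assms by (auto simp: line_points_def simp del: of_nat_le_iff)
  then show ?thesis by simp
qed

lemma line_points_unique:
  assumes "p \<in> line_points A l" "q \<in> line_points A l" "p \<in> line_points A l'" "q \<in> line_points A l'" "p \<noteq> q"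
  shows "l = l'"
proof -
  obtain c a d b where pq: "p = (c, a)" "q = (d, b)" by fastforce
  have e: "real a = fst l * real c + snd l" "real b = fst l * real d + snd l"
    "real a = fst l' * real c + snd l'" "real b = fst l' * real d + snd l'"
    using assms pq by (auto simp: line_points_def)
  have cd: "c \<noteq> d" using e assms(5) pq by auto
  have "(fst l - fst l') * (real c - real d) = 0" using e by (simp add: algebra_simps)
  then have "fst l = fst l'" using cd by simp
  then show ?thesis using e by (simp add: prod_eq_iff)
qed

lemma grid_lines_pair:
  assumes "l \<in> grid_lines A"
  obtains p q where "p \<in> line_points A l" "q \<in> line_points A l" "p \<noteq> q"
proof -
  have "card (line_points A l) \<ge> 2" using assms by (simp add: grid_lines_def)
  then obtain T where "T \<subseteq> line_points A l" "card T = 2" by (metis obtain_subset_with_card_n)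
  then show ?thesis using that by (auto simp: card_2_iff)
qed

text \<open>A line is recovered from any two of its points, so picking an ordered pair of distinct
  points on each line is injective.\<close>

lemma
  assumes "finite A"
  shows finite_grid_lines: "finite (grid_lines A)"
    and card_grid_lines_le: "card (grid_lines A) \<le> card A ^ 4"
proof -
  let ?P = "(A \<times> A) \<times> (A \<times> A)"
  define g where "g l = (SOME z. fst z \<in> line_points A l \<and> snd z \<in> line_points A l \<and> fst z \<noteq> snd z)" for l
  have g: "fst (g l) \<in> line_points A l \<and> snd (g l) \<in> line_points A l \<and> fst (g l) \<noteq> snd (g l)"
    if l: "l \<in> grid_lines A" for l
  proof -
    obtain p q where "p \<in> line_points A l" "q \<in> line_points A l" "p \<noteq> q"
      using grid_lines_pair[OF l] by blast
    then have "\<exists>z. fst z \<in> line_points A l \<and> snd z \<in> line_points A l \<and> fst z \<noteq> snd z"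
      by (intro exI[of _ "(p, q)"]) simp
    then show ?thesis unfolding g_def by (rule someI_ex)
  qed
  have inj: "inj_on g (grid_lines A)"
  proof (rule inj_onI)
    fix l l' assume l: "l \<in> grid_lines A" "l' \<in> grid_lines A" "g l = g l'"
    show "l = l'"
      using line_points_unique[of "fst (g l)" A l "snd (g l)" l'] g[OF l(1)] g[OF l(2)] l(3) by simp
  qed
  have sub: "g ` grid_lines A \<subseteq> ?P"
  proof
    fix z assume "z \<in> g ` grid_lines A"
    then obtain l where l: "z = g l" "l \<in> grid_lines A" by blast
    then show "z \<in> ?P" using g[OF l(2)] line_points_subset[of A l] by (auto simp: mem_Times_iff)
  qed
  have fin: "finite ?P" using assms by simp
  show "finite (grid_lines A)" using inj sub fin by (metis finite_imageD finite_subset)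
  have "card (grid_lines A) \<le> card ?P" by (rule card_inj_on_le[OF inj sub fin])
  also have "\<dots> = card A ^ 4" by (simp add: card_cartesian_product power4_eq_xxxx)
  finally show "card (grid_lines A) \<le> card A ^ 4" .
qed

text \<open>Cut \<open>A\<close> into blocks of \<open>s\<close> consecutive elements. A line of positive slope passes through the
  resulting cells of \<open>A \<times> A\<close> monotonically, so it meets few of them and must contain many pairs of
  points lying in a common cell.\<close>

lemma sum_grid_lines_le:
  assumes "finite A" "s > 0" "L \<subseteq> grid_lines A" and t: "t = 2 * ((card A - 1) div s) + 1"
  shows "(\<Sum>l\<in>L. real (card (line_points A l)) - real t) \<le> real (card A)^2 * real s^2"
proof -
  let ?k = "\<lambda>a. rank_in A a div s"
  define Q where "Q = {(p, q). p \<in> A \<times> A \<and> q \<in> A \<times> A \<and> p \<noteq> q \<and> ?k (fst p) = ?k (fst q)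
      \<and> ?k (snd p) = ?k (snd q)}"
  define QL where "QL l = Q \<inter> line_points A l \<times> line_points A l" for l
  let ?Z = "SIGMA p:A \<times> A. {a \<in> A. ?k a = ?k (fst p)} \<times> {a \<in> A. ?k a = ?k (snd p)}"
  have Z: "finite ?Z" using assms(1) by simp
  have QZ: "Q \<subseteq> ?Z" unfolding Q_def by auto
  have finQ: "finite Q" using Z QZ finite_subset by blast
  have "card Q \<le> card ?Z" using Z QZ by (rule card_mono)
  also have "\<dots> = (\<Sum>p\<in>A \<times> A. card {a \<in> A. ?k a = ?k (fst p)} * card {a \<in> A. ?k a = ?k (snd p)})"
    using assms(1) by (subst card_SigmaI) (auto simp: card_cartesian_product)
  also have "\<dots> \<le> (\<Sum>p\<in>A \<times> A. s * s)"
    by (intro sum_mono mult_mono card_rank_block_le assms) auto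
  also have "\<dots> = card A ^ 2 * s ^ 2" by (simp add: card_cartesian_product power2_eq_square)
  finally have cQ: "card Q \<le> card A ^ 2 * s ^ 2" .
  have one: "card (line_points A l) \<le> t + card (QL l)" if l: "l \<in> L" for l
  proof -
    have pos: "fst l > 0" using l assms(3) by (auto simp: grid_lines_def)
    \<comment> \<open>Along the line both block indices are nondecreasing, so equal sums force equal
      cells. Each index is at most \<open>(card A - 1) div s\<close>, so the sum takes at most
      \<open>t\<close> values.\<close>
    define \<phi> where "\<phi> p = ?k (fst p) + ?k (snd p)" for p :: "nat \<times> nat"
    have bound: "?k a \<le> (card A - 1) div s" if "a \<in> A" for a
      using rank_in_less_card[OF assms(1) that] by (intro div_le_mono) simp
    have im: "\<phi> ` line_points A l \<subseteq> {..<t}"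
    proof
      fix z assume "z \<in> \<phi> ` line_points A l"
      then obtain c a where "z = ?k c + ?k a" "c \<in> A" "a \<in> A"
        by (auto simp: \<phi>_def line_points_def)
      then show "z \<in> {..<t}" using bound[of c] bound[of a] unfolding t by simp
    qed
    have cell: "?k (fst p) = ?k (fst q) \<and> ?k (snd p) = ?k (snd q)"
      if pq: "p \<in> line_points A l" "q \<in> line_points A l" "\<phi> p = \<phi> q" "fst p \<le> fst q" for p q
    proof -
      have "snd p \<le> snd q" using line_points_mono pos pq by blast
      then have "?k (fst p) \<le> ?k (fst q)" "?k (snd p) \<le> ?k (snd q)"
        using pq(4) rank_in_mono[OF assms(1)] div_le_mono by blast+
      then show ?thesis using pq(3) unfolding \<phi>_def by linarith
    qed
    have "card (line_points A l) \<le> card {..<t}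
        + card {(p, q) \<in> line_points A l \<times> line_points A l. p \<noteq> q \<and> \<phi> p = \<phi> q}"
      by (rule card_le_fibre_pairs[OF finite_line_points[OF assms(1)] _ im]) simp
    also have "\<dots> \<le> t + card (QL l)"
    proof -
      have "{(p, q) \<in> line_points A l \<times> line_points A l. p \<noteq> q \<and> \<phi> p = \<phi> q} \<subseteq> QL l"
      proof
        fix z assume "z \<in> {(p, q) \<in> line_points A l \<times> line_points A l. p \<noteq> q \<and> \<phi> p = \<phi> q}"
        then obtain p q where z: "z = (p, q)" "p \<in> line_points A l" "q \<in> line_points A l" "p \<noteq> q" "\<phi> p = \<phi> q"
          by auto
        have "?k (fst p) = ?k (fst q) \<and> ?k (snd p) = ?k (snd q)"
          using cell[of p q] cell[of q p] z by (metis nle_le)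
        then show "z \<in> QL l" using z line_points_subset[of A l] by (auto simp: QL_def Q_def)
      qed
      then show ?thesis using finQ by (simp add: QL_def card_mono)
    qed
    finally show ?thesis .
  qed
  have finL: "finite L" using finite_grid_lines[OF assms(1)] assms(3) finite_subset by blast
  have "(\<Sum>l\<in>L. real (card (line_points A l)) - real t) \<le> (\<Sum>l\<in>L. real (card (QL l)))"
    using one by (intro sum_mono) (simp add: diff_le_eq add.commute flip: of_nat_add)
  \<comment> \<open>Two distinct points lie on at most one common line, so no pair of
    \<open>Q\<close> is charged twice.\<close>
  also have "\<dots> = real (card (\<Union>l\<in>L. QL l))"
  proof -
    have "card (\<Union>l\<in>L. QL l) = (\<Sum>l\<in>L. card (QL l))"
    proof (rule card_UN_disjoint[OF finL])
      show "\<forall>l\<in>L. finite (QL l)" using finQ by (auto simp: QL_def)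
      show "\<forall>i\<in>L. \<forall>j\<in>L. i \<noteq> j \<longrightarrow> QL i \<inter> QL j = {}"
      proof (intro ballI impI, rule ccontr)
        fix i j assume "i \<noteq> j" "QL i \<inter> QL j \<noteq> {}"
        then obtain p q where "p \<noteq> q" "p \<in> line_points A i" "q \<in> line_points A i"
            "p \<in> line_points A j" "q \<in> line_points A j"
          by (auto simp: QL_def Q_def)
        then show False using line_points_unique \<open>i \<noteq> j\<close> by blast
      qed
    qed
    then show ?thesis by simp
  qed
  also have "\<dots> \<le> real (card Q)" using finQ by (intro of_nat_mono card_mono) (auto simp: QL_def)
  also have "\<dots> \<le> real (card A ^ 2 * s ^ 2)" using cQ by (rule of_nat_mono)
  finally show ?thesis by simp
qed

text \<open>This has Szemeredi--Trotter strength. With blocks of about \<open>8 * card A / j\<close>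
  elements, a line with \<open>j\<close> points or more meets at most \<open>j / 2\<close> cells and
  keeps a surplus of at least \<open>j / 2\<close>, whereas \<open>sum_grid_lines_le\<close> bounds
  the total surplus. For \<open>j < 4\<close> counting all lines is enough.\<close>

lemma card_rich_grid_lines_le:
  assumes "finite A" "1 \<le> j" "j \<le> card A"
  shows "real (card {l \<in> grid_lines A. j \<le> card (line_points A l)}) * real j ^ 3 \<le> 162 * real (card A) ^ 4"
proof (cases "j < 4")
  case True
  have "card {l \<in> grid_lines A. j \<le> card (line_points A l)} \<le> card A ^ 4"
    by (rule order_trans[OF card_mono card_grid_lines_le]) (use assms finite_grid_lines in auto)
  then have "real (card {l \<in> grid_lines A. j \<le> card (line_points A l)}) \<le> real (card A) ^ 4"
    by (simp flip: of_nat_power)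
  moreover have "real j ^ 3 \<le> 162"
  proof -
    have "real j ^ 3 \<le> 4 ^ 3" using True by (intro power_mono) auto
    then show ?thesis by simp
  qed
  ultimately have "real (card {l \<in> grid_lines A. j \<le> card (line_points A l)}) * real j ^ 3 \<le> real (card A) ^ 4 * 162"
    by (intro mult_mono) auto
  then show ?thesis by simp
next
  case False
  let ?N = "card A" and ?L = "{l \<in> grid_lines A. j \<le> card (line_points A l)}"
  \<comment> \<open>The added 1 makes \<open>s\<close> exceed \<open>8 * ?N / j\<close>, and
    \<open>j \<le> ?N\<close> keeps it below \<open>9 * ?N / j\<close>, whence
    \<open>162 = 2 * 9 ^ 2\<close>. The 1 inside \<open>t\<close> fits into \<open>j / 2\<close>
    because \<open>j \<ge> 4\<close>.\<close>
  define s where "s = 8 * ?N div j + 1"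
  have j: "real j > 0" "real j \<ge> 4" using False by auto
  have s0: "s > 0" by (simp add: s_def)
  have sl: "real s \<ge> 8 * real ?N / real j"
  proof -
    have "8 * ?N < j * s" unfolding s_def using False dividend_less_times_div[of j "8 * ?N"] by simp
    then have "real (8 * ?N) < real (j * s)" by (rule of_nat_less_iff[THEN iffD2])
    then show ?thesis using j by (simp add: field_simps)
  qed
  have su: "real s \<le> 9 * real ?N / real j"
  proof -
    have "real (8 * ?N div j) \<le> real (8 * ?N) / real j" by (rule of_nat_div_le_of_nat)
    moreover have "1 \<le> real ?N / real j" using assms j by simp
    ultimately show ?thesis unfolding s_def by (simp add: add_divide_distrib)
  qed
  define t where "t = 2 * ((?N - 1) div s) + 1"
  have "real ((?N - 1) div s) \<le> real (?N - 1) / real s" by (rule of_nat_div_le_of_nat)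
  also have "\<dots> \<le> real ?N / real s" by (intro divide_right_mono) auto
  also have "\<dots> \<le> real j / 8"
    using sl j s0 by (simp add: field_simps)
  finally have tj: "real t \<le> real j / 2" using j unfolding t_def by simp
  have "real (card ?L) * (real j / 2) = (\<Sum>l\<in>?L. real j / 2)" by simp
  also have "\<dots> \<le> (\<Sum>l\<in>?L. real (card (line_points A l)) - real t)"
    using tj by (intro sum_mono) (auto simp: le_diff_eq intro: order_trans[of _ "real j"])
  also have "\<dots> \<le> real ?N^2 * real s^2"
    by (rule sum_grid_lines_le[OF assms(1) s0 _ t_def]) auto
  also have "\<dots> \<le> real ?N^2 * (9 * real ?N / real j)^2"
    using su by (intro mult_left_mono power_mono) auto
  finally have "real (card ?L) * (real j / 2) \<le> real ?N^2 * (9 * real ?N / real j)^2" .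
  then have "real (card ?L) * (real j / 2) * (2 * real j ^ 2) \<le> real ?N^2 * (9 * real ?N / real j)^2 * (2 * real j ^ 2)"
    by (rule mult_right_mono) auto
  also have "\<dots> = 162 * real ?N ^ 4" using j
    by (simp add: field_simps power2_eq_square power4_eq_xxxx)
  finally show ?thesis by (simp add: power2_eq_square power3_eq_cube mult.assoc)
qed

text \<open>Telescoping: the cubes of \<open>j - 1\<close> and \<open>j\<close> differ by at most
  \<open>3 * j ^ 2\<close>. It expresses a third moment through richness thresholds.\<close>

lemma cube_le_sum_squares: "real k ^ 3 \<le> 3 * (\<Sum>j=1..k. real j ^ 2)"
proof (induction k)
  case (Suc k)
  have "real (Suc k) ^ 3 \<le> real k ^ 3 + 3 * real (Suc k) ^ 2"
    by (simp add: power2_eq_square power3_eq_cube algebra_simps)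
  then show ?case using Suc by (simp add: algebra_simps)
qed simp

text \<open>Summation by layers: threshold \<open>j\<close> has weight \<open>3 * j ^ 2\<close> and
  at most \<open>162 * card A ^ 4 / j ^ 3\<close> lines, which leaves a harmonic sum with constant
  \<open>486 = 3 * 162\<close>.\<close>

lemma sum_line_points_cubed_le:
  assumes "finite A"
  shows "(\<Sum>l\<in>grid_lines A. real (card (line_points A l)) ^ 3) \<le> 486 * real (card A) ^ 4 * harm (card A)"
proof -
  let ?N = "card A" and ?G = "grid_lines A"
  let ?k = "\<lambda>l. card (line_points A l)"
  have fin: "finite ?G" by (rule finite_grid_lines[OF assms])
  have "(\<Sum>l\<in>?G. real (?k l) ^ 3) \<le> (\<Sum>l\<in>?G. 3 * (\<Sum>j=1..?k l. real j ^ 2))"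
    by (intro sum_mono cube_le_sum_squares)
  also have "\<dots> = (\<Sum>l\<in>?G. \<Sum>j=1..?N. if j \<le> ?k l then 3 * real j ^ 2 else 0)"
  proof (intro sum.cong refl)
    fix l
    have "{1..?k l} = {j \<in> {1..?N}. j \<le> ?k l}" using card_line_points_le[OF assms, of l] by auto
    then show "3 * (\<Sum>j=1..?k l. real j ^ 2) = (\<Sum>j=1..?N. if j \<le> ?k l then 3 * real j ^ 2 else 0)"
      by (simp only: sum_distrib_left sum.inter_filter[OF finite_atLeastAtMost, symmetric])
  qed
  also have "\<dots> = (\<Sum>j=1..?N. \<Sum>l\<in>?G. if j \<le> ?k l then 3 * real j ^ 2 else 0)"
    by (rule sum.swap)
  also have "\<dots> = (\<Sum>j=1..?N. 3 * real j ^ 2 * real (card {l \<in> ?G. j \<le> ?k l}))"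
    by (intro sum.cong refl) (simp add: sum.inter_filter[OF fin, symmetric])
  also have "\<dots> \<le> (\<Sum>j=1..?N. 486 * real ?N ^ 4 * inverse (real j))"
  proof (intro sum_mono)
    fix j assume j: "j \<in> {1..?N}"
    have "real (card {l \<in> ?G. j \<le> ?k l}) * real j ^ 3 \<le> 162 * real ?N ^ 4"
      using j by (intro card_rich_grid_lines_le assms) auto
    then show "3 * real j ^ 2 * real (card {l \<in> ?G. j \<le> ?k l}) \<le> 486 * real ?N ^ 4 * inverse (real j)"
      using j by (simp add: field_simps power2_eq_square power3_eq_cube)
  qed
  also have "\<dots> = 486 * real ?N ^ 4 * harm ?N" by (simp add: harm_def sum_distrib_left)
  finally show ?thesis .
qed

section \<open>The multiplicative energy of the difference representation function\<close>

text \<open>The products are grouped by the common value \<open>x\<close>; as \<open>X\<close>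
  contains every value of \<open>\<phi>\<close>, no matching pair is lost.\<close>

lemma correlation_sum:
  fixes w :: "'i \<Rightarrow> real" and v :: "'j \<Rightarrow> real"
  assumes "finite I" "finite J" "finite X" "\<phi> ` I \<subseteq> X"
  shows "(\<Sum>x\<in>X. (\<Sum>i\<in>I. if \<phi> i = x then w i else 0) * (\<Sum>j\<in>J. if \<psi> j = x then v j else 0))
    = (\<Sum>i\<in>I. \<Sum>j\<in>J. if \<phi> i = \<psi> j then w i * v j else 0)"
proof -
  have "(\<Sum>x\<in>X. (\<Sum>i\<in>I. if \<phi> i = x then w i else 0) * (\<Sum>j\<in>J. if \<psi> j = x then v j else 0))
    = (\<Sum>x\<in>X. \<Sum>i\<in>I. if \<phi> i = x then w i * (\<Sum>j\<in>J. if \<psi> j = x then v j else 0) else 0)"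
    by (simp add: sum_distrib_right if_distrib[of "\<lambda>z. z * _"] cong: if_cong)
  also have "\<dots> = (\<Sum>i\<in>I. \<Sum>x\<in>X. if \<phi> i = x then w i * (\<Sum>j\<in>J. if \<psi> j = x then v j else 0) else 0)"
    by (rule sum.swap)
  also have "\<dots> = (\<Sum>i\<in>I. w i * (\<Sum>j\<in>J. if \<psi> j = \<phi> i then v j else 0))"
    using assms by (intro sum.cong refl) (auto simp: sum.delta')
  also have "\<dots> = (\<Sum>i\<in>I. \<Sum>j\<in>J. if \<phi> i = \<psi> j then w i * v j else 0)"
    by (intro sum.cong refl) (auto simp: sum_distrib_left intro!: sum.cong)
  finally show ?thesis .
qed

text \<open>Cauchy--Schwarz for the fibre sums over common values. It serves both to double the
  iteration exponent and to separate the weights \<open>f\<close> from the tuples.\<close>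

lemma correlation_Cauchy_Schwarz:
  fixes w :: "'i \<Rightarrow> real" and v :: "'j \<Rightarrow> real"
  assumes "finite I" "finite J"
  shows "(\<Sum>i\<in>I. \<Sum>j\<in>J. if \<phi> i = \<psi> j then w i * v j else 0)\<^sup>2
    \<le> (\<Sum>i\<in>I. \<Sum>i'\<in>I. if \<phi> i = \<phi> i' then w i * w i' else 0)
      * (\<Sum>j\<in>J. \<Sum>j'\<in>J. if \<psi> j = \<psi> j' then v j * v j' else 0)"
proof -
  let ?X = "\<phi> ` I \<union> \<psi> ` J"
  have X: "finite ?X" "\<phi> ` I \<subseteq> ?X" "\<psi> ` J \<subseteq> ?X" using assms by auto
  show ?thesis
    using Cauchy_Schwarz_ineq_sum[of "\<lambda>x. \<Sum>i\<in>I. if \<phi> i = x then w i else 0"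
        "\<lambda>x. \<Sum>j\<in>J. if \<psi> j = x then v j else 0" ?X]
    unfolding power2_eq_square
      correlation_sum[OF assms(1,2) X(1,2)] correlation_sum[OF assms(1,1) X(1,2)]
      correlation_sum[OF assms(2,2) X(1,3)] .
qed

text \<open>Multiplicative coincidences are expressed as equal ratios, so that the correlation
  lemmas apply with the quotient as label.\<close>

definition mult_energy :: "(nat \<Rightarrow> real) \<Rightarrow> nat set \<Rightarrow> real" where
  "mult_energy f B = (\<Sum>z\<in>B \<times> B. \<Sum>z'\<in>B \<times> B.
     if real (fst z) / real (snd z) = real (fst z') / real (snd z')
     then f (fst z) * f (snd z) * (f (fst z') * f (snd z')) else 0)"

definition pos_diffs :: "nat set \<Rightarrow> nat set" where
  "pos_diffs A = {n. 0 < n \<and> int n \<in> diff_set A}"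

lemma finite_pos_diffs: "finite A \<Longrightarrow> finite (pos_diffs A)"
  unfolding pos_diffs_def
  by (rule finite_subset[of _ "nat ` diff_set A"]) (force intro: finite_diff_set)+

text \<open>If \<open>a - b = x * (c - d)\<close>, then \<open>(c, a)\<close> and
  \<open>(d, b)\<close> lie on one line of slope \<open>x\<close>; the left side therefore counts
  certain ordered pairs of points on such lines.\<close>

lemma ratio_correlation_le:
  assumes fin: "finite A" and x: "x > 0"
  shows "(\<Sum>z\<in>pos_diffs A \<times> pos_diffs A. if real (fst z) / real (snd z) = x
      then real (diff_rep A (int (fst z))) * real (diff_rep A (int (snd z))) else 0)
    \<le> (\<Sum>l\<in>{l \<in> grid_lines A. fst l = x}. real (card (line_points A l)) ^ 2)"
proof -
  let ?B = "pos_diffs A" and ?G = "{l \<in> grid_lines A. fst l = x}"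
  define D where "D m = {(a, b). a \<in> A \<and> b \<in> A \<and> int a - int b = int m}" for m
  have finD: "finite (D m)" for m
    by (rule finite_subset[of _ "A \<times> A"]) (use fin in \<open>auto simp: D_def\<close>)
  have rD: "diff_rep A (int m) = card (D m)" for m by (simp add: diff_rep_def D_def)
  define Z where "Z = {z \<in> ?B \<times> ?B. real (fst z) / real (snd z) = x}"
  have finZ: "finite Z" unfolding Z_def using finite_pos_diffs[OF fin] by simp
  have finG: "finite ?G" using finite_grid_lines[OF fin] by simp
  have "(\<Sum>z\<in>?B \<times> ?B. if real (fst z) / real (snd z) = x
      then real (diff_rep A (int (fst z))) * real (diff_rep A (int (snd z))) else 0)
     = real (\<Sum>z\<in>Z. card (D (fst z) \<times> D (snd z)))"
    unfolding Z_def using finite_pos_diffs[OF fin]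
    by (subst sum.inter_filter) (auto simp: card_cartesian_product rD intro!: sum.cong)
  also have "(\<Sum>z\<in>Z. card (D (fst z) \<times> D (snd z))) = card (SIGMA z:Z. D (fst z) \<times> D (snd z))"
    using finZ finD by simp
  also have "card (SIGMA z:Z. D (fst z) \<times> D (snd z)) \<le> card (\<Union>l\<in>?G. line_points A l \<times> line_points A l)"
  \<comment> \<open>The component \<open>z\<close> is recovered from the differences
    \<open>a - b\<close> and \<open>c - d\<close>.\<close>
  proof (rule card_inj_on_le[where f = "\<lambda>(z, (a, b), (c, d)). ((c, a), (d, b))"])
    show "inj_on (\<lambda>(z, (a, b), (c, d)). ((c, a), (d, b))) (SIGMA z:Z. D (fst z) \<times> D (snd z))"
      by (auto simp: inj_on_def D_def prod_eq_iff)
    show "finite (\<Union>l\<in>?G. line_points A l \<times> line_points A l)"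
      using finG finite_line_points[OF fin] by simp
    show "(\<lambda>(z, (a, b), (c, d)). ((c, a), (d, b))) ` (SIGMA z:Z. D (fst z) \<times> D (snd z))
        \<subseteq> (\<Union>l\<in>?G. line_points A l \<times> line_points A l)"
    proof clarify
      fix m n a b c d
      assume z: "(m, n) \<in> Z" and ab: "(a, b) \<in> D (fst (m, n))" and cd: "(c, d) \<in> D (snd (m, n))"
      have A: "a \<in> A" "b \<in> A" "c \<in> A" "d \<in> A" using ab cd by (auto simp: D_def)
      have n0: "n > 0" using z by (auto simp: Z_def pos_diffs_def)
      have e: "a = b + m" "c = d + n" using ab cd by (auto simp: D_def)
      have m: "real m = x * real n" using z n0 by (auto simp: Z_def field_simps)
      let ?l = "(x, real a - x * real c)"
      have 1: "(c, a) \<in> line_points A ?l" "(d, b) \<in> line_points A ?l"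
        using A m e by (auto simp: line_points_def algebra_simps)
      have "card {(c, a), (d, b)} \<le> card (line_points A ?l)"
        using 1 by (intro card_mono finite_line_points fin) auto
      moreover have "card {(c, a), (d, b)} = 2" using e n0 by auto
      ultimately have "?l \<in> ?G" using x by (simp add: grid_lines_def)
      then show "((c, a), d, b) \<in> (\<Union>l\<in>?G. line_points A l \<times> line_points A l)" using 1 by blast
    qed
  qed
  also have "\<dots> \<le> (\<Sum>l\<in>?G. card (line_points A l \<times> line_points A l))"
    by (rule card_UN_le[OF finG])
  also have "real \<dots> = (\<Sum>l\<in>?G. real (card (line_points A l)) ^ 2)"
    by (simp add: card_cartesian_product power2_eq_square)
  finally show ?thesis by simp
qed

text \<open>Parallel lines are disjoint, so each grid point is counted at most once.\<close>

lemma sum_parallel_line_points_le: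
  assumes fin: "finite A"
  shows "(\<Sum>l\<in>{l \<in> grid_lines A. fst l = x}. real (card (line_points A l))) \<le> real (card A) ^ 2"
proof -
  let ?G = "{l \<in> grid_lines A. fst l = x}"
  have finG: "finite ?G" using finite_grid_lines[OF fin] by simp
  have "(\<Sum>l\<in>?G. card (line_points A l)) = card (\<Union>l\<in>?G. line_points A l)"
    by (rule card_UN_disjoint[symmetric])
      (use finG finite_line_points[OF fin] in \<open>auto simp: line_points_def prod_eq_iff\<close>)
  also have "\<dots> \<le> card (A \<times> A)"
    using fin line_points_subset by (intro card_mono) blast+
  also have "\<dots> = card A ^ 2" by (simp add: card_cartesian_product power2_eq_square)
  finally show ?thesis by (simp flip: of_nat_power of_nat_sum)
qed

text \<open>The energy is a sum over slopes of squared ratio counts. Each square is at most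
  \<open>card A ^ 2\<close> times the third moment of the lines of that slope, and every line has
  only one slope.\<close>

lemma mult_energy_diff_rep_le:
  assumes fin: "finite A"
  shows "mult_energy (\<lambda>n. real (diff_rep A (int n))) (pos_diffs A)
    \<le> 486 * real (card A) ^ 6 * harm (card A)"
proof -
  let ?B = "pos_diffs A" and ?r = "\<lambda>n. real (diff_rep A (int n))"
  let ?q = "\<lambda>z. real (fst z) / real (snd z)"
  let ?k = "\<lambda>l. real (card (line_points A l))"
  define X where "X = ?q ` (?B \<times> ?B)"
  define \<rho> where "\<rho> x = (\<Sum>z\<in>?B \<times> ?B. if ?q z = x then ?r (fst z) * ?r (snd z) else 0)" for x
  have finB: "finite (?B \<times> ?B)" using finite_pos_diffs[OF fin] by simp
  have finX: "finite X" using finB by (simp add: X_def)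
  have finG: "finite (grid_lines A)" by (rule finite_grid_lines[OF fin])
  have "mult_energy ?r ?B = (\<Sum>x\<in>X. \<rho> x * \<rho> x)"
    unfolding mult_energy_def \<rho>_def
    by (rule correlation_sum[symmetric, OF finB finB finX]) (simp add: X_def)
  also have "\<dots> \<le> (\<Sum>x\<in>X. real (card A) ^ 2 * (\<Sum>l\<in>{l \<in> grid_lines A. fst l = x}. ?k l ^ 3))"
  proof (intro sum_mono)
    fix x assume "x \<in> X"
    then have x: "x > 0" by (auto simp: X_def pos_diffs_def)
    let ?G = "{l \<in> grid_lines A. fst l = x}"
    have "0 \<le> \<rho> x" unfolding \<rho>_def by (intro sum_nonneg) auto
    moreover have "\<rho> x \<le> (\<Sum>l\<in>?G. ?k l ^ 2)" unfolding \<rho>_def by (rule ratio_correlation_le[OF fin x])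
    ultimately have "\<rho> x ^ 2 \<le> (\<Sum>l\<in>?G. ?k l ^ 2) ^ 2" by (intro power_mono)
    \<comment> \<open>Splitting the square into exponents 1/2 and 3/2 makes Cauchy--Schwarz produce
      the first and third moments, both under control.\<close>
    also have "(\<Sum>l\<in>?G. ?k l ^ 2) = (\<Sum>l\<in>?G. sqrt (?k l) * (sqrt (?k l) * ?k l))"
      by (intro sum.cong refl) (simp add: power2_eq_square flip: mult.assoc)
    also have "\<dots> ^ 2 \<le> (\<Sum>l\<in>?G. sqrt (?k l) ^ 2) * (\<Sum>l\<in>?G. (sqrt (?k l) * ?k l) ^ 2)"
      by (rule Cauchy_Schwarz_ineq_sum)
    also have "\<dots> = (\<Sum>l\<in>?G. ?k l) * (\<Sum>l\<in>?G. ?k l ^ 3)"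
      by (simp add: power_mult_distrib) (simp add: power2_eq_square power3_eq_cube mult.assoc)
    also have "\<dots> \<le> real (card A) ^ 2 * (\<Sum>l\<in>?G. ?k l ^ 3)"
      by (intro mult_right_mono sum_parallel_line_points_le fin sum_nonneg) auto
    finally show "\<rho> x * \<rho> x \<le> real (card A) ^ 2 * (\<Sum>l\<in>?G. ?k l ^ 3)" by (simp add: power2_eq_square)
  qed
  also have "\<dots> = real (card A) ^ 2 * (\<Sum>x\<in>X. \<Sum>l\<in>{l \<in> grid_lines A. fst l = x}. ?k l ^ 3)"
    by (simp add: sum_distrib_left)
  also have "(\<Sum>x\<in>X. \<Sum>l\<in>{l \<in> grid_lines A. fst l = x}. ?k l ^ 3)
      = (\<Sum>l\<in>(\<Union>x\<in>X. {l \<in> grid_lines A. fst l = x}). ?k l ^ 3)"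
    using finX finG by (intro sum.UNION_disjoint[symmetric]) auto
  also have "\<dots> \<le> (\<Sum>l\<in>grid_lines A. ?k l ^ 3)"
    using finG by (intro sum_mono2) auto
  also have "\<dots> \<le> 486 * real (card A) ^ 4 * harm (card A)" by (rule sum_line_points_cubed_le[OF fin])
  finally have "mult_energy ?r ?B \<le> real (card A) ^ 2 * (486 * real (card A) ^ 4 * harm (card A))"
    by (simp add: mult_left_mono)
  also have "\<dots> = 486 * (real (card A) ^ 2 * real (card A) ^ 4) * harm (card A)" by simp
  also have "real (card A) ^ 2 * real (card A) ^ 4 = real (card A) ^ 6" by (simp flip: power_add)
  finally show ?thesis .
qed

section \<open>Equal products\<close>

text \<open>For positive \<open>n\<close> this is the \<open>l\<close>-fold divisor function,
  counting ordered factorizations into \<open>l\<close> factors; the recursion is Dirichlet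
  convolution with the constant 1.\<close>

fun piltz :: "nat \<Rightarrow> nat \<Rightarrow> nat" where
  "piltz 0 n = (if n = 1 then 1 else 0)"
| "piltz (Suc l) n = (\<Sum>d | d dvd n. piltz l (n div d))"

definition tuples :: "nat \<Rightarrow> nat \<Rightarrow> nat list set" where
  "tuples Y k = {xs. set xs \<subseteq> {1..Y} \<and> length xs = k}"

lemma finite_tuples: "finite (tuples Y k)"
  unfolding tuples_def by (rule finite_lists_length_eq) simp

lemma prod_list_tuples_pos: "xs \<in> tuples Y k \<Longrightarrow> prod_list xs > 0"
proof -
  have "set xs \<subseteq> {1..Y} \<Longrightarrow> prod_list xs > 0" by (induction xs) auto
  then show "xs \<in> tuples Y k \<Longrightarrow> prod_list xs > 0" by (simp add: tuples_def)
qed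

lemma tuples_0: "tuples Y 0 = {[]}" by (auto simp: tuples_def)

lemma tuples_Suc: "tuples Y (Suc k) = (\<lambda>(x, xs). x # xs) ` ({1..Y} \<times> tuples Y k)"
  by (auto simp: tuples_def length_Suc_conv image_iff)

text \<open>Every divisor of \<open>a * b\<close> is a divisor of \<open>a\<close> times a divisor
  of \<open>b\<close>, possibly in several ways, so summing over pairs of divisors gives an upper
  bound.\<close>

lemma piltz_mult_le:
  "a > 0 \<Longrightarrow> b > 0 \<Longrightarrow> piltz l (a * b) \<le> piltz l a * piltz l b"
proof (induction l arbitrary: a b)
  case 0
  then show ?case by simp
next
  case (Suc l)
  let ?D = "{d. d dvd a} \<times> {d. d dvd b}"
  have fin: "finite ?D" using Suc.prems by simp
  have im: "{d. d dvd a * b} = (\<lambda>(x, y). x * y) ` ?D"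
  proof (intro equalityI subsetI)
    fix d assume "d \<in> {d. d dvd a * b}"
    then obtain x y where "d = x * y" "x dvd a" "y dvd b" using division_decomp[of d a b] by auto
    then show "d \<in> (\<lambda>(x, y). x * y) ` ?D" by auto
  qed (auto intro: mult_dvd_mono)
  have "piltz (Suc l) (a * b) = sum (\<lambda>d. piltz l (a * b div d)) ((\<lambda>(x, y). x * y) ` ?D)"
    by (simp add: im)
  also have "\<dots> \<le> sum ((\<lambda>d. piltz l (a * b div d)) \<circ> (\<lambda>(x, y). x * y)) ?D"
    by (rule sum_image_le[OF fin]) simp
  also have "\<dots> \<le> (\<Sum>(x, y)\<in>?D. piltz l (a div x) * piltz l (b div y))"
  proof (rule sum_mono)
    fix z assume z: "z \<in> ?D"
    obtain x y where xy: "z = (x, y)" "x dvd a" "y dvd b" using z by auto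
    have "a * b div (x * y) = (a div x) * (b div y)" using xy by (simp add: div_mult_div_if_dvd)
    moreover have "a div x > 0" "b div y > 0"
      using xy Suc.prems by (auto simp: div_greater_zero_iff dvd_imp_le dest: dvd_pos_nat)
    ultimately show "((\<lambda>d. piltz l (a * b div d)) \<circ> (\<lambda>(x, y). x * y)) z
        \<le> (case z of (x, y) \<Rightarrow> piltz l (a div x) * piltz l (b div y))"
      using Suc.IH xy(1) by simp
  qed
  also have "\<dots> = piltz (Suc l) a * piltz (Suc l) b"
    by (simp add: sum_product sum.cartesian_product)
  finally show ?case .
qed

lemma piltz_1: "piltz l 1 = 1"
  by (induction l) auto

lemma piltz_prod_list_le:
  "set xs \<subseteq> {1..Y} \<Longrightarrow> piltz l (prod_list xs) \<le> prod_list (map (piltz l) xs)"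
proof (induction xs)
  case Nil
  then show ?case using piltz_1 by simp
next
  case (Cons x xs)
  have "prod_list xs > 0" using Cons.prems by (intro prod_list_tuples_pos[of _ Y "length xs"]) (auto simp: tuples_def)
  then have "piltz l (x * prod_list xs) \<le> piltz l x * piltz l (prod_list xs)"
    using Cons.prems by (intro piltz_mult_le) auto
  also have "\<dots> \<le> piltz l x * prod_list (map (piltz l) xs)" using Cons by simp
  finally show ?case by simp
qed

text \<open>Removing the first entry \<open>d\<close> leaves product \<open>n div d\<close>, which
  is the recursion of \<open>piltz\<close>; the cap \<open>Y\<close> on the entries can only lose
  tuples.\<close>

lemma card_tuples_prod_list_le:
  "n > 0 \<Longrightarrow> card {xs \<in> tuples Y l. prod_list xs = n} \<le> piltz l n"
proof (induction l arbitrary: n)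
  case 0
  have "{xs \<in> tuples Y 0. prod_list xs = n} = (if n = 1 then {[]} else {})" by (auto simp: tuples_0)
  then show ?case by simp
next
  case (Suc l)
  let ?S = "SIGMA d:{d. d dvd n}. {xs \<in> tuples Y l. prod_list xs = n div d}"
  have fin: "finite ?S" using Suc.prems finite_tuples by auto
  have "{xs \<in> tuples Y (Suc l). prod_list xs = n} \<subseteq> (\<lambda>(x, xs). x # xs) ` ?S"
    using Suc.prems by (auto simp: tuples_Suc image_iff)
  then have "card {xs \<in> tuples Y (Suc l). prod_list xs = n} \<le> card ?S"
    using fin by (meson card_image_le card_mono finite_imageI le_trans)
  also have "\<dots> = (\<Sum>d | d dvd n. card {xs \<in> tuples Y l. prod_list xs = n div d})"
    using Suc.prems finite_tuples by (subst card_SigmaI) auto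
  also have "\<dots> \<le> (\<Sum>d | d dvd n. piltz l (n div d))"
    using Suc.prems by (intro sum_mono Suc.IH) (auto simp: div_greater_zero_iff dvd_imp_le dest: dvd_pos_nat)
  finally show ?case by simp
qed

text \<open>Writing \<open>n = d * e\<close> splits the weight \<open>1 / n\<close>. Enlarging the
  region \<open>d * e \<le> Y\<close> to a square then separates one factor \<open>harm Y\<close>
  per step.\<close>

lemma sum_piltz_le: "(\<Sum>n=1..Y. real (piltz l n) / real n) \<le> harm Y ^ l"
proof (induction l)
  case 0
  have "(\<Sum>n=1..Y. real (piltz 0 n) / real n) = (\<Sum>n=1..Y. if n = 1 then 1 else 0)"
    by (intro sum.cong) auto
  also have "\<dots> \<le> 1" by simp
  finally show ?case by simp
next
  case (Suc l)
  let ?S = "SIGMA n:{1..Y}. {d. d dvd n}"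
  let ?g = "\<lambda>(n::nat, d). (d, n div d)"
  let ?h = "\<lambda>(d, e). inverse (real d) * (real (piltz l e) / real e)"
  have inj: "inj_on ?g ?S"
  proof (rule inj_onI, clarify)
    fix n d n' :: nat assume "d dvd n" "d dvd n'" "n div d = n' div d"
    then show "n = n' \<and> d = d" by (auto elim!: dvdE)
  qed
  have sub: "?g ` ?S \<subseteq> {1..Y} \<times> {1..Y}"
  proof clarify
    fix n d assume n: "n \<in> {1..Y}" "d dvd n"
    then obtain e where e: "n = d * e" by (auto elim: dvdE)
    then have "d > 0" "e > 0" using n by (auto intro: gr0I)
    moreover from this have "d \<le> d * e" "e \<le> d * e" by auto
    moreover have "d * e \<le> Y" using n e by simp
    ultimately have "1 \<le> d" "1 \<le> e" "d \<le> Y" "e \<le> Y" by linarith+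
    then show "d \<in> {1..Y} \<and> n div d \<in> {1..Y}" by (simp add: e)
  qed
  have "(\<Sum>n=1..Y. real (piltz (Suc l) n) / real n) = (\<Sum>n=1..Y. \<Sum>d | d dvd n. real (piltz l (n div d)) / real n)"
    by (simp add: sum_divide_distrib)
  also have "\<dots> = (\<Sum>(n, d)\<in>?S. real (piltz l (n div d)) / real n)"
    by (subst sum.Sigma) auto
  also have "\<dots> = (\<Sum>z\<in>?S. ?h (?g z))"
    by (intro sum.cong refl) (auto simp: real_of_nat_div field_simps elim!: dvdE)
  also have "\<dots> = (\<Sum>z\<in>?g ` ?S. ?h z)" by (simp only: sum.reindex[OF inj] comp_def)
  also have "\<dots> \<le> (\<Sum>z\<in>{1..Y} \<times> {1..Y}. ?h z)"
    using sub by (intro sum_mono2) auto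
  also have "\<dots> = harm Y * (\<Sum>n=1..Y. real (piltz l n) / real n)"
    by (simp add: harm_def sum_product sum.cartesian_product)
  also have "\<dots> \<le> harm Y * harm Y ^ l" by (intro mult_left_mono Suc harm_nonneg)
  finally show ?case by simp
qed

lemma sum_tuples_prod_list:
  fixes \<phi> :: "nat \<Rightarrow> real"
  shows "(\<Sum>xs\<in>tuples Y l. prod_list (map \<phi> xs)) = (\<Sum>n=1..Y. \<phi> n) ^ l"
proof (induction l)
  case (Suc l)
  have inj: "inj_on (\<lambda>(x, xs). x # xs) ({1..Y} \<times> tuples Y l)" by (auto simp: inj_on_def)
  have "(\<Sum>xs\<in>tuples Y (Suc l). prod_list (map \<phi> xs))
      = (\<Sum>(x, xs)\<in>{1..Y} \<times> tuples Y l. \<phi> x * prod_list (map \<phi> xs))"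
    unfolding tuples_Suc by (subst sum.reindex[OF inj]) (auto intro!: sum.cong)
  also have "\<dots> = (\<Sum>n=1..Y. \<phi> n) * (\<Sum>xs\<in>tuples Y l. prod_list (map \<phi> xs))"
    by (simp add: sum_product sum.cartesian_product)
  finally show ?case using Suc by simp
qed (simp add: tuples_0)

text \<open>Fixing \<open>v\<close>, the number of \<open>u\<close> is at most a divisor function at \<open>prod_list v\<close>, whose
  submultiplicativity decouples the entries of \<open>v\<close>.\<close>

lemma sum_equal_products_le:
  "(\<Sum>u\<in>tuples Y l. \<Sum>v\<in>tuples Y l. if prod_list u = prod_list v then 1 / real (prod_list v) else 0)
    \<le> harm Y ^ (l * l)"
proof -
  have "(\<Sum>u\<in>tuples Y l. \<Sum>v\<in>tuples Y l. if prod_list u = prod_list v then 1 / real (prod_list v) else 0)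
    = (\<Sum>v\<in>tuples Y l. \<Sum>u\<in>tuples Y l. if prod_list u = prod_list v then 1 / real (prod_list v) else 0)"
    by (rule sum.swap)
  also have "\<dots> = (\<Sum>v\<in>tuples Y l. real (card {u \<in> tuples Y l. prod_list u = prod_list v}) / real (prod_list v))"
    by (intro sum.cong refl) (simp add: sum.inter_filter[OF finite_tuples, symmetric])
  also have "\<dots> \<le> (\<Sum>v\<in>tuples Y l. prod_list (map (\<lambda>n. real (piltz l n) / real n) v))"
  proof (rule sum_mono)
    fix v assume v: "v \<in> tuples Y l"
    have "card {u \<in> tuples Y l. prod_list u = prod_list v} \<le> piltz l (prod_list v)"
      using prod_list_tuples_pos[OF v] by (rule card_tuples_prod_list_le)
    also have "\<dots> \<le> prod_list (map (piltz l) v)"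
      using v by (intro piltz_prod_list_le) (auto simp: tuples_def)
    finally have "real (card {u \<in> tuples Y l. prod_list u = prod_list v}) \<le> real (prod_list (map (piltz l) v))"
      by simp
    then have "real (card {u \<in> tuples Y l. prod_list u = prod_list v}) / real (prod_list v)
        \<le> real (prod_list (map (piltz l) v)) / real (prod_list v)"
      by (rule divide_right_mono) simp
    also have "real (prod_list (map (piltz l) v)) / real (prod_list v)
        = prod_list (map (\<lambda>n. real (piltz l n) / real n) v)"
      by (induction v) (simp_all flip: times_divide_times_eq)
    finally show "real (card {u \<in> tuples Y l. prod_list u = prod_list v}) / real (prod_list v)
        \<le> prod_list (map (\<lambda>n. real (piltz l n) / real n) v)" .
  qed
  also have "\<dots> = (\<Sum>n=1..Y. real (piltz l n) / real n) ^ l" by (rule sum_tuples_prod_list)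
  also have "\<dots> \<le> (harm Y ^ l) ^ l" by (intro power_mono sum_piltz_le sum_nonneg) auto
  finally show ?thesis by (simp add: power_mult)
qed

section \<open>Iterated GCD forms\<close>

text \<open>With \<open>P\<close> as above this is \<open>\<langle>f, P\<^sup>k f\<rangle>\<close>.\<close>

definition gcd_form :: "(nat \<Rightarrow> real) \<Rightarrow> nat set \<Rightarrow> nat \<Rightarrow> nat \<Rightarrow> real" where
  "gcd_form f B Y k = (\<Sum>(m, n, u, v)\<in>B \<times> B \<times> tuples Y k \<times> tuples Y k.
     if m * prod_list u = n * prod_list v
     then f m * f n / sqrt (real (prod_list u) * real (prod_list v)) else 0)"

lemma tuples_append: "u \<in> tuples Y k \<Longrightarrow> v \<in> tuples Y l \<Longrightarrow> u @ v \<in> tuples Y (k + l)"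
  by (auto simp: tuples_def)

lemma tuples_take: "w \<in> tuples Y (k + l) \<Longrightarrow> take k w \<in> tuples Y k"
  by (auto simp: tuples_def dest: in_set_takeD)

lemma tuples_drop: "w \<in> tuples Y (k + l) \<Longrightarrow> drop k w \<in> tuples Y l"
  by (auto simp: tuples_def dest: in_set_dropD)

lemma nat_cross_mult_eq_iff:
  fixes m n a b :: nat
  assumes "a > 0" "b > 0"
  shows "real m / real a = real n / real b \<longleftrightarrow> m * b = n * a"
  using assms by (simp add: field_simps flip: of_nat_mult)

text \<open>Since \<open>P\<close> is self-adjoint, the squared norm of \<open>P^k f\<close> is the
  form with exponent \<open>2k\<close>, so this is Cauchy--Schwarz for \<open>f\<close> against
  \<open>P^k f\<close>. The terms of \<open>P^k f\<close> are given by the position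
  \<open>\<psi>\<close> and the weight \<open>w\<close>.\<close>

lemma gcd_form_square_le:
  assumes finB: "finite B"
  shows "gcd_form f B Y k ^ 2 \<le> (\<Sum>n\<in>B. f n ^ 2) * gcd_form f B Y (k + k)"
proof -
  let ?T = "tuples Y k"
  let ?J = "B \<times> ?T \<times> ?T"
  define \<psi> where "\<psi> = (\<lambda>(n, u, v). real n * real (prod_list v) / real (prod_list u))"
  define w where "w = (\<lambda>(n, u, v). f n / sqrt (real (prod_list u) * real (prod_list v)))"
  have finJ: "finite ?J" using finB finite_tuples by auto
  have eq1: "gcd_form f B Y k = (\<Sum>m\<in>B. \<Sum>j\<in>?J. if real m = \<psi> j then f m * w j else 0)"
    unfolding gcd_form_def sum.cartesian_product
  proof (intro sum.cong refl, clarify)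
    fix m n u v assume "u \<in> ?T" "v \<in> ?T"
    then have "prod_list u > 0" using prod_list_tuples_pos by blast
    then have "real m = real n * real (prod_list v) / real (prod_list u) \<longleftrightarrow> m * prod_list u = n * prod_list v"
      using nat_cross_mult_eq_iff[of 1 "prod_list u" m "n * prod_list v"] by simp
    then show "(if m * prod_list u = n * prod_list v
        then f m * f n / sqrt (real (prod_list u) * real (prod_list v)) else 0) =
      (if real m = \<psi> (n, u, v) then f m * w (n, u, v) else 0)"
      by (simp add: \<psi>_def w_def)
  qed
  have eq2: "(\<Sum>m\<in>B. \<Sum>m'\<in>B. if real m = real m' then f m * f m' else 0) = (\<Sum>n\<in>B. f n ^ 2)"
    using finB by (simp add: power2_eq_square)
  have eq3: "(\<Sum>j\<in>?J. \<Sum>j'\<in>?J. if \<psi> j = \<psi> j' then w j * w j' else 0) = gcd_form f B Y (k + k)"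
    unfolding gcd_form_def sum.cartesian_product
  \<comment> \<open>Clearing denominators in \<open>\<psi> j = \<psi> j'\<close> moves
    \<open>u'\<close> next to \<open>v\<close> and \<open>u\<close> next to \<open>v'\<close>; these
    concatenations are the tuples of length \<open>k + k\<close>.\<close>
  proof (rule sum.reindex_bij_witness[where
        j = "\<lambda>((n, u, v), (n', u', v')). (n, n', v @ u', v' @ u)" and
        i = "\<lambda>(n, n', x, y). ((n, drop k y, take k x), (n', drop k x, take k y))"], goal_cases)
    case (1 z)
    then show ?case by (auto simp: tuples_def)
  next
    case (2 z)
    then show ?case by (auto intro: tuples_append)
  next
    case (3 z)
    then show ?case by auto
  next
    case (4 z)
    then show ?case by (auto intro: tuples_take tuples_drop)
  next
    case (5 z)
    obtain n u v n' u' v' where z: "z = ((n, u, v), (n', u', v'))" by (metis surj_pair)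
    have T: "u \<in> ?T" "v \<in> ?T" "u' \<in> ?T" "v' \<in> ?T" using 5 z by auto
    then have p: "prod_list u > 0" "prod_list u' > 0" using prod_list_tuples_pos by blast+
    have "\<psi> (n, u, v) = \<psi> (n', u', v') \<longleftrightarrow> n * (prod_list v * prod_list u') = n' * (prod_list v' * prod_list u)"
      using nat_cross_mult_eq_iff[OF p, of "n * prod_list v" "n' * prod_list v'"]
      by (simp add: \<psi>_def mult.assoc)
    then show ?case by (simp add: z w_def real_sqrt_mult mult_ac)
  qed
  show ?thesis
    using correlation_Cauchy_Schwarz[OF finB finJ, of real \<psi> f w] unfolding eq1[symmetric] eq2 eq3 .
qed

text \<open>The condition says \<open>m / n = prod_list v / prod_list u\<close>. Cauchy--Schwarz
  over this ratio leaves the energy of \<open>f\<close> in one factor and only solutions of equal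
  products of \<open>k + k\<close> entries in the other.\<close>

lemma gcd_form_square_le_mult_energy:
  assumes finB: "finite B" and B0: "0 \<notin> B"
  shows "gcd_form f B Y k ^ 2 \<le> mult_energy f B * harm Y ^ ((k + k) * (k + k))"
proof -
  let ?T = "tuples Y k" and ?T2 = "tuples Y (k + k)"
  define \<phi> where "\<phi> z = real (fst z) / real (snd z)" for z :: "nat \<times> nat"
  define \<psi> where "\<psi> = (\<lambda>(u, v). real (prod_list v) / real (prod_list u))"
  define w where "w = (\<lambda>(u, v). 1 / sqrt (real (prod_list u) * real (prod_list v)))"
  define g where "g z = f (fst z) * f (snd z)" for z
  have eq1: "gcd_form f B Y k = (\<Sum>z\<in>B \<times> B. \<Sum>j\<in>?T \<times> ?T. if \<phi> z = \<psi> j then g z * w j else 0)"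
    unfolding gcd_form_def sum.cartesian_product
  proof (rule sum.reindex_bij_witness[where
        j = "\<lambda>(m, n, u, v). ((m, n), (u, v))" and
        i = "\<lambda>((m, n), (u, v)). (m, n, u, v)"], goal_cases)
    case (5 z)
    obtain m n u v where z: "z = (m, n, u, v)" by (metis surj_pair)
    have "n > 0" using 5 z B0 by (auto intro: gr0I)
    moreover have "prod_list u > 0" using 5 z prod_list_tuples_pos by blast
    ultimately have "\<phi> (m, n) = \<psi> (u, v) \<longleftrightarrow> m * prod_list u = n * prod_list v"
      by (simp add: \<phi>_def \<psi>_def nat_cross_mult_eq_iff mult.commute)
    then show ?case by (simp add: z g_def w_def)
  qed auto
  have eq2: "(\<Sum>z\<in>B \<times> B. \<Sum>z'\<in>B \<times> B. if \<phi> z = \<phi> z' then g z * g z' else 0) = mult_energy f B"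
    unfolding mult_energy_def \<phi>_def g_def ..
  have eq3: "(\<Sum>j\<in>?T \<times> ?T. \<Sum>j'\<in>?T \<times> ?T. if \<psi> j = \<psi> j' then w j * w j' else 0)
      = (\<Sum>x\<in>?T2. \<Sum>y\<in>?T2. if prod_list x = prod_list y then 1 / real (prod_list y) else 0)"
    unfolding sum.cartesian_product
  proof (rule sum.reindex_bij_witness[where
        j = "\<lambda>((u, v), (u', v')). (v @ u', v' @ u)" and
        i = "\<lambda>(x, y). ((drop k y, take k x), (drop k x, take k y))"], goal_cases)
    case (1 z)
    then show ?case by (auto simp: tuples_def)
  next
    case (2 z)
    then show ?case by (auto intro: tuples_append)
  next
    case (3 z)
    then show ?case by auto
  next
    case (4 z)
    then show ?case by (auto intro: tuples_take tuples_drop)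
  next
    case (5 z)
    obtain u v u' v' where z: "z = ((u, v), (u', v'))" by (metis surj_pair)
    have T: "u \<in> ?T" "v \<in> ?T" "u' \<in> ?T" "v' \<in> ?T" using 5 z by auto
    then have p: "prod_list u > 0" "prod_list u' > 0" using prod_list_tuples_pos by blast+
    have iff: "\<psi> (u, v) = \<psi> (u', v') \<longleftrightarrow> prod_list v * prod_list u' = prod_list v' * prod_list u"
      using nat_cross_mult_eq_iff[OF p, of "prod_list v" "prod_list v'"] by (simp add: \<psi>_def)
    \<comment> \<open>On solutions the two products under the root agree, so the root
      disappears.\<close>
    have "w (u, v) * w (u', v') = 1 / real (prod_list v' * prod_list u)"
      if e: "prod_list v * prod_list u' = prod_list v' * prod_list u"
    proof -
      have "w (u, v) * w (u', v') = 1 / sqrt (real (prod_list v * prod_list u') * real (prod_list v' * prod_list u))"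
        by (simp add: w_def real_sqrt_mult mult_ac)
      also have "\<dots> = 1 / real (prod_list v' * prod_list u)" unfolding e by (simp only: real_sqrt_mult real_sqrt_mult_self abs_of_nat)
      finally show ?thesis .
    qed
    then show ?case using iff by (simp add: z)
  qed
  have "gcd_form f B Y k ^ 2 \<le> mult_energy f B
      * (\<Sum>x\<in>?T2. \<Sum>y\<in>?T2. if prod_list x = prod_list y then 1 / real (prod_list y) else 0)"
    using correlation_Cauchy_Schwarz[of "B \<times> B" "?T \<times> ?T" \<phi> \<psi> g w] finB finite_tuples
    unfolding eq1[symmetric] eq2 eq3 by simp
  also have "\<dots> \<le> mult_energy f B * harm Y ^ ((k + k) * (k + k))"
  proof (rule mult_left_mono[OF sum_equal_products_le])
    \<comment> \<open>As \<open>f\<close> may change sign, nonnegativity is read off from a sum of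
      squares over ratios.\<close>
    have "(\<Sum>x\<in>\<phi> ` (B \<times> B). (\<Sum>z\<in>B \<times> B. if \<phi> z = x then g z else 0) * (\<Sum>z\<in>B \<times> B. if \<phi> z = x then g z else 0))
        = mult_energy f B"
      unfolding eq2[symmetric] using finB by (intro correlation_sum) auto
    moreover have "\<dots> \<ge> 0" by (subst calculation[symmetric]) (simp add: sum_nonneg)
    ultimately show "0 \<le> mult_energy f B" by simp
  qed
  finally show ?thesis .
qed

lemma gcd_form_nonneg: "(\<And>n. n \<in> B \<Longrightarrow> f n \<ge> 0) \<Longrightarrow> gcd_form f B Y k \<ge> 0"
  unfolding gcd_form_def by (intro sum_nonneg) auto

text \<open>Squaring the bound for \<open>2 ^ j\<close> and applying
  \<open>gcd_form_square_le\<close> doubles the exponent; nonnegativity of \<open>f\<close> permits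
  the squaring.\<close>

lemma gcd_form_power_le:
  assumes "finite B" "\<And>n. n \<in> B \<Longrightarrow> f n \<ge> 0"
  shows "gcd_form f B Y 1 ^ (2 ^ j) \<le> (\<Sum>n\<in>B. f n ^ 2) ^ (2 ^ j - 1) * gcd_form f B Y (2 ^ j)"
proof (induction j)
  case (Suc j)
  let ?s = "\<Sum>n\<in>B. f n ^ 2"
  have "gcd_form f B Y 1 ^ (2 ^ Suc j) = (gcd_form f B Y 1 ^ (2 ^ j)) ^ 2"
    by (simp only: power_Suc2 power_mult)
  also have "\<dots> \<le> (?s ^ (2 ^ j - 1) * gcd_form f B Y (2 ^ j)) ^ 2"
    using Suc by (intro power_mono zero_le_power gcd_form_nonneg assms)
  also have "\<dots> = (?s ^ (2 ^ j - 1)) ^ 2 * gcd_form f B Y (2 ^ j) ^ 2" by (rule power_mult_distrib)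
  also have "\<dots> \<le> (?s ^ (2 ^ j - 1)) ^ 2 * (?s * gcd_form f B Y (2 ^ j + 2 ^ j))"
    by (intro mult_left_mono gcd_form_square_le assms) simp
  also have "\<dots> = ?s ^ (2 * (2 ^ j - 1) + 1) * gcd_form f B Y (2 ^ Suc j)"
    by (simp add: power_mult[symmetric] mult.commute mult_2 mult.left_commute)
  also have "2 * (2 ^ j - 1) + 1 = (2 ^ Suc j - 1 :: nat)"
  proof -
    have "(2::nat) ^ j \<ge> 1" by simp
    then show ?thesis unfolding power_Suc by linarith
  qed
  finally show ?case .
qed simp

section \<open>The GCD sum over differences\<close>

lemma harm_le: "n > 0 \<Longrightarrow> harm n \<le> 1 + ln (real n)"
proof (induction n rule: nat_induct_non_zero)
  case (Suc n)
  have "ln (real n / real (Suc n)) \<le> real n / real (Suc n) - 1"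
    using Suc.hyps by (intro ln_le_minus_one) simp
  also have "\<dots> = - inverse (real (Suc n))" by (simp add: field_simps)
  finally have "ln (real n) - ln (real (Suc n)) \<le> - inverse (real (Suc n))"
    using Suc.hyps by (simp add: ln_div)
  then show ?case using Suc.IH by (simp add: harm_Suc)
qed (simp add: harm_def)

lemma sum_diff_rep_le:
  assumes "finite A" "finite S"
  shows "(\<Sum>n\<in>S. diff_rep A n) \<le> card A ^ 2"
proof -
  let ?D = "\<lambda>n. {(a, b). a \<in> A \<and> b \<in> A \<and> int a - int b = n}"
  have fin: "finite (?D n)" for n
    by (rule finite_subset[of _ "A \<times> A"]) (use assms in auto)
  have "(\<Sum>n\<in>S. diff_rep A n) = card (\<Union>n\<in>S. ?D n)"
    unfolding diff_rep_def
    by (rule card_UN_disjoint[symmetric]) (use assms fin in auto)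
  also have "\<dots> \<le> card (A \<times> A)" using assms by (intro card_mono) auto
  finally show ?thesis by (simp add: card_cartesian_product power2_eq_square)
qed

lemma diff_rep_le:
  assumes "finite A"
  shows "diff_rep A n \<le> card A"
  unfolding diff_rep_def
  by (rule card_inj_on_le[where f = fst]) (use assms in \<open>auto simp: inj_on_def\<close>)

lemma diff_rep_0: "diff_rep A 0 = card A"
proof -
  have "{(a, b). a \<in> A \<and> b \<in> A \<and> int a - int b = 0} = (\<lambda>a. (a, a)) ` A" by auto
  then show ?thesis unfolding diff_rep_def by (simp add: card_image inj_on_def)
qed

text \<open>The difference 0 alone contributes this much. It allows an error \<open>N ^ 2\<close> to
  be absorbed into the energy.\<close>

lemma card_square_le_additive_energy:
  assumes "finite A"
  shows "card A ^ 2 \<le> additive_energy A"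
proof (cases "A = {}")
  case False
  then have "0 \<in> diff_set A" by (force simp: diff_set_def)
  then have "(diff_rep A 0)\<^sup>2 \<le> (\<Sum>n\<in>diff_set A. (diff_rep A n)\<^sup>2)"
    using finite_diff_set[OF assms] by (intro member_le_sum) auto
  then show ?thesis by (simp add: additive_energy_eq_sum[OF assms] diff_rep_0)
qed simp

lemma additive_energy_le_card_cube:
  assumes "finite A"
  shows "additive_energy A \<le> card A ^ 3"
proof -
  have "additive_energy A \<le> (\<Sum>n\<in>diff_set A. card A * diff_rep A n)"
    unfolding additive_energy_eq_sum[OF assms] power2_eq_square
    by (intro sum_mono mult_right_mono diff_rep_le assms) simp
  also have "\<dots> = card A * (\<Sum>n\<in>diff_set A. diff_rep A n)" by (simp add: sum_distrib_left)
  also have "\<dots> \<le> card A * card A ^ 2"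
    by (intro mult_left_mono sum_diff_rep_le finite_diff_set assms) simp
  finally show ?thesis by (simp add: power2_eq_square power3_eq_cube)
qed

lemma pos_diff_set_eq: "{n \<in> diff_set A. n > 0} = int ` pos_diffs A"
  by (auto simp: pos_diffs_def image_iff intro!: exI[of _ "nat _"])

lemma sum_squares_pos_diffs_le:
  assumes "finite A"
  shows "(\<Sum>n\<in>pos_diffs A. real (diff_rep A (int n)) ^ 2) \<le> real (additive_energy A)"
proof -
  have "(\<Sum>n\<in>pos_diffs A. (diff_rep A (int n))\<^sup>2) = (\<Sum>n\<in>int ` pos_diffs A. (diff_rep A n)\<^sup>2)"
    by (simp add: sum.reindex)
  also have "\<dots> \<le> additive_energy A"
    unfolding additive_energy_eq_sum[OF assms] pos_diff_set_eq[symmetric]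
    using finite_diff_set[OF assms] by (intro sum_mono2) auto
  finally show ?thesis by (simp flip: of_nat_power of_nat_sum)
qed

text \<open>In lowest terms \<open>m / n = p / q\<close> the weight is \<open>1 / sqrt (p * q)\<close>. Pairs with \<open>p\<close> or \<open>q\<close> above
  \<open>N\<^sup>4\<close> contribute at most \<open>N\<^sup>2\<close> in total, and the others occur in the form with \<open>k = 1\<close>.\<close>

lemma gcd_term_le:
  assumes m: "m > 0" and n: "n > 0" and N: "N > 0" and Y: "Y = N ^ 4"
  shows "real (gcd m n) / sqrt (real m * real n) \<le> 1 / real N ^ 2 +
    (\<Sum>z\<in>tuples Y 1 \<times> tuples Y 1. if m * prod_list (fst z) = n * prod_list (snd z)
      then 1 / sqrt (real (prod_list (fst z)) * real (prod_list (snd z))) else 0)"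
    (is "_ \<le> _ + (\<Sum>z\<in>?T. ?h z)")
proof -
  define g where "g = gcd m n"
  obtain p q where pq: "m = g * p" "n = g * q" unfolding g_def by (metis dvdE gcd_dvd1 gcd_dvd2)
  have pos: "g > 0" "p > 0" "q > 0" using pq m n by (auto intro: gr0I)
  have "sqrt (real m * real n) = sqrt ((real g * real g) * (real p * real q))" by (simp add: pq mult_ac)
  also have "\<dots> = real g * sqrt (real p * real q)" unfolding real_sqrt_mult[of "real g * real g"] by simp
  finally have eq: "real (gcd m n) / sqrt (real m * real n) = 1 / sqrt (real p * real q)"
    using pos by (simp flip: g_def)
  have hnn: "?h z \<ge> 0" for z by simp
  have fin: "finite ?T" using finite_tuples by blast
  show ?thesis
  proof (cases "p \<le> Y \<and> q \<le> Y")
    case True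
    \<comment> \<open>With \<open>m = g * p\<close> and \<open>n = g * q\<close> one has
      \<open>m * q = n * p\<close>.\<close>
    let ?z = "([q], [p])"
    have "?z \<in> ?T" using True pos by (auto simp: tuples_def)
    then have "?h ?z \<le> (\<Sum>z\<in>?T. ?h z)" using fin by (intro member_le_sum) auto
    moreover have "?h ?z = 1 / sqrt (real p * real q)" using pq by (simp add: mult_ac)
    ultimately show ?thesis unfolding eq using N by (simp add: add_increasing)
  next
    case False
    have "Y \<le> p * q"
    proof (cases "p \<le> Y")
      case True
      then have "Y \<le> 1 * q" using False by simp
      also have "\<dots> \<le> p * q" using pos by (intro mult_right_mono) auto
      finally show ?thesis .
    next
      case False
      then have "Y \<le> p * 1" by simp
      also have "\<dots> \<le> p * q" using pos by (intro mult_left_mono) auto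
      finally show ?thesis .
    qed
    then have "real Y \<le> real p * real q" by (simp flip: of_nat_mult)
    then have "(real N ^ 2) ^ 2 \<le> real p * real q" by (simp add: Y)
    then have "real N ^ 2 \<le> sqrt (real p * real q)" by (rule real_le_rsqrt)
    then have "1 / sqrt (real p * real q) \<le> 1 / real N ^ 2" using N pos by (intro divide_left_mono) auto
    moreover have "(\<Sum>z\<in>?T. ?h z) \<ge> 0" by (intro sum_nonneg hnn)
    ultimately show ?thesis unfolding eq by linarith
  qed
qed

text \<open>The error \<open>1 / card A ^ 2\<close> per pair meets total weight at most
  \<open>card A ^ 4\<close>, since the values of \<open>diff_rep\<close> sum to at most
  \<open>card A ^ 2\<close>. This explains the cutoff \<open>card A ^ 4\<close>.\<close>

lemma gcd_sum_le_gcd_form: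
  assumes fin: "finite A" and N: "card A > 0"
  shows "(\<Sum>m\<in>{n \<in> diff_set A. n > 0}. \<Sum>n\<in>{n \<in> diff_set A. n > 0}.
          real_of_int (gcd m n) / sqrt (real_of_int m * real_of_int n)
            * real (diff_rep A m) * real (diff_rep A n))
    \<le> real (card A) ^ 2 + gcd_form (\<lambda>n. real (diff_rep A (int n))) (pos_diffs A) (card A ^ 4) 1"
proof -
  let ?B = "pos_diffs A" and ?r = "\<lambda>n. real (diff_rep A (int n))" and ?N = "real (card A)"
  let ?T = "tuples (card A ^ 4) 1 \<times> tuples (card A ^ 4) 1"
  let ?h = "\<lambda>m n z. if m * prod_list (fst z) = n * prod_list (snd z)
      then 1 / sqrt (real (prod_list (fst z)) * real (prod_list (snd z))) else 0"
  have sumr: "(\<Sum>n\<in>?B. ?r n) \<le> ?N ^ 2"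
  proof -
    have "(\<Sum>n\<in>?B. diff_rep A (int n)) = (\<Sum>n\<in>int ` ?B. diff_rep A n)" by (simp add: sum.reindex)
    also have "\<dots> \<le> card A ^ 2" using fin by (intro sum_diff_rep_le finite_imageI finite_pos_diffs)
    finally show ?thesis by (simp flip: of_nat_power of_nat_sum)
  qed
  have "(\<Sum>m\<in>{n \<in> diff_set A. n > 0}. \<Sum>n\<in>{n \<in> diff_set A. n > 0}.
          real_of_int (gcd m n) / sqrt (real_of_int m * real_of_int n)
            * real (diff_rep A m) * real (diff_rep A n))
     = (\<Sum>m\<in>?B. \<Sum>n\<in>?B. real (gcd m n) / sqrt (real m * real n) * (?r m * ?r n))"
    unfolding pos_diff_set_eq by (simp add: sum.reindex mult.assoc)
  also have "\<dots> \<le> (\<Sum>m\<in>?B. \<Sum>n\<in>?B. (1 / ?N ^ 2 + (\<Sum>z\<in>?T. ?h m n z)) * (?r m * ?r n))"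
    by (intro sum_mono mult_right_mono gcd_term_le[OF _ _ N refl]) (auto simp: pos_diffs_def)
  also have "\<dots> = (\<Sum>m\<in>?B. \<Sum>n\<in>?B. 1 / ?N ^ 2 * (?r m * ?r n))
      + (\<Sum>m\<in>?B. \<Sum>n\<in>?B. (\<Sum>z\<in>?T. ?h m n z) * (?r m * ?r n))"
    by (simp only: distrib_right sum.distrib)
  also have "(\<Sum>m\<in>?B. \<Sum>n\<in>?B. 1 / ?N ^ 2 * (?r m * ?r n)) = 1 / ?N ^ 2 * ((\<Sum>n\<in>?B. ?r n) * (\<Sum>n\<in>?B. ?r n))"
    unfolding sum_product by (simp only: sum_distrib_left)
  also have "\<dots> \<le> 1 / ?N ^ 2 * (?N ^ 2 * ?N ^ 2)"
    using sumr by (intro mult_left_mono mult_mono sum_nonneg) auto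
  also have "\<dots> = ?N ^ 2" using N by (simp add: field_simps)
  also have "(\<Sum>m\<in>?B. \<Sum>n\<in>?B. (\<Sum>z\<in>?T. ?h m n z) * (?r m * ?r n))
      = (\<Sum>m\<in>?B. \<Sum>n\<in>?B. \<Sum>z\<in>?T. ?h m n z * (?r m * ?r n))"
    by (simp only: sum_distrib_right)
  also have "\<dots> = gcd_form ?r ?B (card A ^ 4) 1"
    unfolding gcd_form_def sum.cartesian_product
    by (intro sum.cong refl) (auto split: prod.splits)
  finally show ?thesis by simp
qed

text \<open>Minimality of \<open>j\<close> places \<open>2 ^ j\<close> within a factor 2 of the
  square root of \<open>\<kappa> / \<Lambda>\<close>, unless \<open>j = 0\<close> already
  suffices.\<close>

lemma power_two_scale:
  fixes \<kappa> \<Lambda> :: real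
  assumes "\<kappa> \<ge> 0" "\<Lambda> > 0"
  obtains j :: nat where "\<kappa> \<le> (2 ^ j)\<^sup>2 * \<Lambda>" "j = 0 \<or> (2 ^ j)\<^sup>2 * \<Lambda> \<le> 4 * \<kappa>"
proof -
  define P where "P j \<longleftrightarrow> \<kappa> \<le> (2 ^ j)\<^sup>2 * \<Lambda>" for j :: nat
  obtain i :: nat where "\<kappa> / \<Lambda> < 2 ^ i" using real_arch_pow[of 2 "\<kappa> / \<Lambda>"] by auto
  moreover have "(2::real) ^ i \<le> (2 ^ i)\<^sup>2" by (simp add: power2_eq_square)
  ultimately have "P i" using assms unfolding P_def by (simp add: field_simps) (meson less_eq_real_def mult_left_mono order_trans)
  then have L: "P (LEAST j. P j)" by (rule LeastI)
  show thesis
  proof (rule that[of "LEAST j. P j"])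
    show "\<kappa> \<le> (2 ^ (LEAST j. P j))\<^sup>2 * \<Lambda>" using L by (simp add: P_def)
    show "(LEAST j. P j) = 0 \<or> (2 ^ (LEAST j. P j))\<^sup>2 * \<Lambda> \<le> 4 * \<kappa>"
    proof (cases "LEAST j. P j")
      case (Suc j)
      then have "\<not> P j" using not_less_Least[of j P] by simp
      then have "(2 ^ Suc j)\<^sup>2 * \<Lambda> \<le> 4 * \<kappa>" by (simp add: P_def power_mult_distrib)
      then show ?thesis unfolding Suc ..
    qed simp
  qed
qed

theorem theorem4:
  shows "\<exists>(C::real) (K\<^sub>1::real) (K\<^sub>2::real) (N\<^sub>0::nat). C > 0 \<and> K\<^sub>1 > 0 \<and> K\<^sub>2 > 0 \<and>
    (\<forall>(A::nat set) (N::nat). finite A \<and> card A = N \<and> N \<ge> N\<^sub>0 \<longrightarrow>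
      (\<Sum>m\<in>{n \<in> diff_set A. n > 0}. \<Sum>n\<in>{n \<in> diff_set A. n > 0}.
          real_of_int (gcd m n) / sqrt (real_of_int m * real_of_int n)
            * real (diff_rep A m) * real (diff_rep A n))
      \<le> C * (ln (real N) powr K\<^sub>1
          * exp (K\<^sub>2 * sqrt (ln (real N ^ 3 / real (additive_energy A)) * ln (ln (real N))))
          * real (additive_energy A)))"
proof (rule exI[of _ 973], rule exI[of _ 5], rule exI[of _ 9], rule exI[of _ 243], intro conjI allI impI)
  \<comment> \<open>Here \<open>973 = 2 * 486 + 1\<close>: the 2 comes from
    \<open>harm N \<le> 2 * L\<close> and the 1 from the error \<open>N ^ 2\<close>. The exponents 5
    and 9 are half of the 10 and 18 in \<open>expo\<close>, since a root of order
    \<open>k * 2\<close> is taken.\<close>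
  fix A :: "nat set" and N :: nat
  assume "finite A \<and> card A = N \<and> N \<ge> 243"
  then have fin: "finite A" and cA: "card A = N" and N: "N \<ge> 243" by auto
  define r where "r n = real (diff_rep A (int n))" for n
  define B where "B = pos_diffs A"
  define E where "E = real (additive_energy A)"
  define L where "L = ln (real N)"
  define \<Lambda> where "\<Lambda> = ln L"
  define K where "K = real N ^ 3 / E"
  define \<kappa> where "\<kappa> = ln K"
  define \<sigma> where "\<sigma> = sqrt (\<kappa> * \<Lambda>)"
  define G where "G = gcd_form r B (N ^ 4) 1"
  have E_ge: "real N ^ 2 \<le> E" and E_le: "E \<le> real N ^ 3"
    using card_square_le_additive_energy[OF fin] additive_energy_le_card_cube[OF fin]
    unfolding E_def cA by (simp_all flip: of_nat_power)
  have N0: "real N > 0" using N by simp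
  have E0: "E > 0" using E_ge N0 by (meson less_le_trans zero_less_power)
  have K1: "K \<ge> 1" using E_le E0 by (simp add: K_def)
  have \<kappa>0: "\<kappa> \<ge> 0" using K1 by (simp add: \<kappa>_def)
  \<comment> \<open>The threshold is \<open>243 = 3 ^ 5\<close>, via \<open>exp 1 \<le> 3\<close>.
    The bound 5 gives \<open>1 + 4 * L \<le> L ^ 2\<close> below.\<close>
  have L5: "L \<ge> 5"
  proof -
    have "exp (5::real) = exp 1 ^ 5" by (simp flip: exp_of_nat_mult)
    also have "\<dots> \<le> 3 ^ 5" by (intro power_mono exp_le) simp
    also have "\<dots> \<le> real N" using N by simp
    finally show ?thesis using N0 by (simp add: L_def ln_ge_iff)
  qed
  have \<Lambda>1: "\<Lambda> \<ge> 1"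
    using L5 exp_le by (simp add: \<Lambda>_def ln_ge_iff)
  have LE: "exp (real i * \<Lambda>) = L ^ i" for i using L5 by (simp add: \<Lambda>_def exp_of_nat_mult)
  have KE: "exp (2 * \<kappa>) = K ^ 2" using K1 by (simp add: \<kappa>_def exp_double)
  have \<sigma>0: "\<sigma> \<ge> 0" using \<kappa>0 \<Lambda>1 by (simp add: \<sigma>_def)
  have \<sigma>2: "\<sigma> * \<sigma> = \<kappa> * \<Lambda>" using \<kappa>0 \<Lambda>1 by (simp add: \<sigma>_def)

  have finB: "finite B" unfolding B_def by (rule finite_pos_diffs[OF fin])
  have B0: "0 \<notin> B" by (simp add: B_def pos_diffs_def)
  have r0: "r n \<ge> 0" for n by (simp add: r_def)
  have G0: "G \<ge> 0" unfolding G_def by (intro gcd_form_nonneg r0)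
  have sE: "(\<Sum>n\<in>B. r n ^ 2) \<le> E" unfolding B_def r_def E_def by (rule sum_squares_pos_diffs_le[OF fin])
  have M: "mult_energy r B \<le> 972 * L * (K ^ 2 * E ^ 2)"
  proof -
    have "mult_energy r B \<le> 486 * real N ^ 6 * harm N"
      using mult_energy_diff_rep_le[OF fin] unfolding r_def[abs_def] B_def cA .
    also have "\<dots> \<le> 486 * real N ^ 6 * (2 * L)"
      using harm_le[of N] N L5 by (intro mult_left_mono) (auto simp: L_def)
    also have "real N ^ 6 = K ^ 2 * E ^ 2"
      using E0 by (simp add: K_def power_divide flip: power_mult)
    finally show ?thesis by (simp add: mult_ac)
  qed
  have H: "harm (N ^ 4) \<le> L ^ 2"
  proof -
    have "harm (N ^ 4) \<le> 1 + ln (real (N ^ 4))" using N by (intro harm_le) simp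
    also have "ln (real (N ^ 4)) = 4 * L" using N0 by (simp add: L_def ln_realpow)
    also have "1 + 4 * L \<le> 5 * L" using L5 by simp
    also have "\<dots> \<le> L ^ 2" using L5 by (simp add: power2_eq_square)
    finally show ?thesis .
  qed

  obtain j :: nat where j: "\<kappa> \<le> (2 ^ j)\<^sup>2 * \<Lambda>" "j = 0 \<or> (2 ^ j)\<^sup>2 * \<Lambda> \<le> 4 * \<kappa>"
    using power_two_scale[OF \<kappa>0, of \<Lambda>] \<Lambda>1 by auto
  define k where "k = (2::nat) ^ j"
  define x where "x = real k"
  have k1: "k \<ge> 1" by (simp add: k_def)
  have x1: "x \<ge> 1" using k1 by (simp add: x_def)
  have j': "\<kappa> \<le> x\<^sup>2 * \<Lambda>" "x = 1 \<or> x\<^sup>2 * \<Lambda> \<le> 4 * \<kappa>" using j by (auto simp: x_def k_def)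
  \<comment> \<open>As \<open>\<sigma>\<close> is the geometric mean of \<open>\<kappa>\<close> and
    \<open>\<Lambda>\<close>, this is the lower bound on \<open>x\<close> multiplied by
    \<open>\<kappa>\<close>.\<close>
  have \<kappa>\<sigma>: "\<kappa> \<le> x * \<sigma>"
  proof (rule power2_le_imp_le)
    have "\<kappa>\<^sup>2 \<le> \<kappa> * (x\<^sup>2 * \<Lambda>)" unfolding power2_eq_square[of \<kappa>] by (rule mult_left_mono[OF j'(1) \<kappa>0])
    also have "\<dots> = x\<^sup>2 * (\<sigma> * \<sigma>)" by (simp add: \<sigma>2)
    finally show "\<kappa>\<^sup>2 \<le> (x * \<sigma>)\<^sup>2" by (simp add: power2_eq_square mult_ac)
    show "0 \<le> x * \<sigma>" using x1 \<sigma>0 by simp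
  qed
  have x\<Lambda>: "x = 1 \<or> x * \<Lambda> \<le> 2 * \<sigma>"
  proof (cases "x = 1")
    case False
    then have "x\<^sup>2 * \<Lambda> * \<Lambda> \<le> 4 * \<kappa> * \<Lambda>" using j'(2) \<Lambda>1 by (intro mult_right_mono) auto
    then have "(x * \<Lambda>)\<^sup>2 \<le> (2 * \<sigma>)\<^sup>2" using \<sigma>2 by (simp add: power2_eq_square mult_ac)
    then have "x * \<Lambda> \<le> 2 * \<sigma>" by (rule power2_le_imp_le) (use \<sigma>0 in simp)
    then show ?thesis ..
  qed simp
  \<comment> \<open>For \<open>x = 1\<close> the quadratic term is a fixed multiple of
    \<open>\<Lambda>\<close> and goes into the power of \<open>L\<close>. Otherwise it is at most
    \<open>16 * x * \<sigma>\<close>, and \<open>2 * \<kappa>\<close> supplies the other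
    \<open>2 * x * \<sigma>\<close>.\<close>
  have expo: "\<Lambda> + 2 * \<kappa> + 8 * x\<^sup>2 * \<Lambda> \<le> 10 * x * \<Lambda> + 18 * x * \<sigma>"
  proof (cases "x = 1")
    case True
    then show ?thesis using \<kappa>\<sigma> \<Lambda>1 \<sigma>0 by simp
  next
    case False
    then have "x * (x * \<Lambda>) \<le> x * (2 * \<sigma>)" using x\<Lambda> x1 by (intro mult_left_mono) auto
    then have "8 * x\<^sup>2 * \<Lambda> \<le> 16 * x * \<sigma>" by (simp add: power2_eq_square mult_ac)
    moreover have "1 * \<Lambda> \<le> x * \<Lambda>" using x1 \<Lambda>1 by (intro mult_right_mono) auto
    moreover have "0 \<le> x * \<Lambda>" using x1 \<Lambda>1 by simp
    ultimately show ?thesis using \<kappa>\<sigma> by linarith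
  qed

  have "G ^ k \<le> (\<Sum>n\<in>B. r n ^ 2) ^ (k - 1) * gcd_form r B (N ^ 4) k"
    unfolding G_def k_def by (rule gcd_form_power_le[OF finB r0])
  also have "\<dots> \<le> E ^ (k - 1) * gcd_form r B (N ^ 4) k"
    using sE by (intro mult_right_mono power_mono sum_nonneg gcd_form_nonneg r0) auto
  finally have "(G ^ k)\<^sup>2 \<le> (E ^ (k - 1) * gcd_form r B (N ^ 4) k)\<^sup>2"
    using G0 by (intro power_mono) auto
  also have "\<dots> = (E ^ (k - 1))\<^sup>2 * (gcd_form r B (N ^ 4) k)\<^sup>2" by (rule power_mult_distrib)
  also have "\<dots> \<le> (E ^ (k - 1))\<^sup>2 * (mult_energy r B * harm (N ^ 4) ^ ((k + k) * (k + k)))"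
    by (intro mult_left_mono gcd_form_square_le_mult_energy finB B0) simp
  also have "\<dots> \<le> (E ^ (k - 1))\<^sup>2 * (972 * L * (K ^ 2 * E ^ 2) * (L ^ 2) ^ ((k + k) * (k + k)))"
    using M H L5 E0 by (intro mult_left_mono mult_mono power_mono harm_nonneg zero_le_power) auto
  also have "\<dots> = (E ^ (k - 1) * E)\<^sup>2 * (972 * (L * K ^ 2 * L ^ (2 * ((k + k) * (k + k)))))"
    by (simp add: power_mult_distrib power_mult[of L 2, symmetric] mult_ac)
  \<comment> \<open>The factor \<open>E ^ 2\<close> from the multiplicative energy supplies the
    power of \<open>E\<close> missing after the iteration.\<close>
  also have "E ^ (k - 1) * E = E ^ k" using k1 by (simp flip: power_Suc2)
  also have "L * K ^ 2 * L ^ (2 * ((k + k) * (k + k))) = exp (\<Lambda> + 2 * \<kappa> + 8 * x\<^sup>2 * \<Lambda>)"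
  proof -
    have "L = exp \<Lambda>" using L5 by (simp add: \<Lambda>_def)
    moreover have "L ^ (2 * ((k + k) * (k + k))) = exp (8 * x\<^sup>2 * \<Lambda>)"
      unfolding LE[symmetric] by (simp add: x_def power2_eq_square algebra_simps)
    ultimately show ?thesis by (simp only: exp_add KE)
  qed
  \<comment> \<open>Raising 972 to the power \<open>k * 2\<close> makes the right side a perfect
    power, ready for the root.\<close>
  also have "(E ^ k)\<^sup>2 * (972 * exp (\<Lambda> + 2 * \<kappa> + 8 * x\<^sup>2 * \<Lambda>))
      \<le> (E ^ k)\<^sup>2 * (972 ^ (k * 2) * exp (10 * x * \<Lambda> + 18 * x * \<sigma>))"
    using expo k1 by (intro mult_left_mono mult_mono self_le_power) auto
  also have "\<dots> = (E * (972 * (L ^ 5 * exp (9 * \<sigma>)))) ^ (k * 2)"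
  proof -
    have "(L ^ 5) ^ (k * 2) = exp (10 * x * \<Lambda>)"
      using LE[of "5 * (k * 2)"] by (simp add: x_def mult_ac flip: power_mult)
    moreover have "exp (9 * \<sigma>) ^ (k * 2) = exp (18 * x * \<sigma>)"
      by (simp add: x_def algebra_simps flip: exp_of_nat_mult)
    ultimately show ?thesis by (simp only: power_mult_distrib exp_add power_mult[of E])
  qed
  finally have "G ^ (k * 2) \<le> (E * (972 * (L ^ 5 * exp (9 * \<sigma>)))) ^ (k * 2)" by (simp only: power_mult)
  then have G_le: "G \<le> E * (972 * (L ^ 5 * exp (9 * \<sigma>)))"
    using k1 E0 L5 G0 by (subst (asm) power_mono_iff) auto

  have "(\<Sum>m\<in>{n \<in> diff_set A. n > 0}. \<Sum>n\<in>{n \<in> diff_set A. n > 0}.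
          real_of_int (gcd m n) / sqrt (real_of_int m * real_of_int n)
            * real (diff_rep A m) * real (diff_rep A n)) \<le> real N ^ 2 + G"
    using gcd_sum_le_gcd_form[OF fin] N unfolding cA G_def r_def[abs_def] B_def by simp
  also have "\<dots> \<le> E * 1 + E * (972 * (L ^ 5 * exp (9 * \<sigma>)))" using E_ge G_le by simp
  also have "\<dots> \<le> E * (L ^ 5 * exp (9 * \<sigma>)) + E * (972 * (L ^ 5 * exp (9 * \<sigma>)))"
  proof -
    have "1 * 1 \<le> L ^ 5 * exp (9 * \<sigma>)" using L5 \<sigma>0 by (intro mult_mono one_le_power) auto
    then show ?thesis using E0 by (intro add_right_mono mult_left_mono) auto
  qed
  also have "\<dots> = 973 * (L powr 5 * exp (9 * \<sigma>) * E)" using L5 by (simp add: powr_numeral)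
  finally show "(\<Sum>m\<in>{n \<in> diff_set A. n > 0}. \<Sum>n\<in>{n \<in> diff_set A. n > 0}.
          real_of_int (gcd m n) / sqrt (real_of_int m * real_of_int n)
            * real (diff_rep A m) * real (diff_rep A n))
      \<le> 973 * (ln (real N) powr 5
          * exp (9 * sqrt (ln (real N ^ 3 / real (additive_energy A)) * ln (ln (real N))))
          * real (additive_energy A))"
    unfolding \<sigma>_def \<kappa>_def K_def \<Lambda>_def L_def E_def .
qed simp_all

end
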